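(* Let $G=(U,V,E)$ be a finite bipartite graph, $p,q$ positive integers, $R$ an injective ranking of $U\cup V$, and $s:U\to\{\text{node},\text{edge}\}$ a given split-choice function. Then the procedure NPivoter described in the context, using the minimum non-neighbor candidate partition rule in NPC, runs in time $O(|E|\,2^{n_{max}/2})$, where $n_{max}=\max_{u\in U}|N(u)|+\max_{v\in V}|N(v)|$.
   Context: $N(x)$ denotes the neighbours of $x$; binomials satisfy $\binom{n}{k}=0$ if $k<0$ or $k>n$. Cost model: arithmetic and binomial-coefficient evaluations take constant time. Procedure NPC$(C_U,C_V,P_U,P_V,H_U,H_V)$ (with $C_U,P_U,H_U\subseteq U$, $C_V,P_V,H_V\subseteq V$) updates a global counter $cnt$: (1) If there is no edge between $C_U$ and $C_V$, or $|H_U|=p$, or $|H_V|=q$: set $c_0=|C_U|,c_1=|C_V|,p_0=|P_U|,p_1=|P_V|,h_0=|H_U|,h_1=|H_V|$; if $c_0=0$ or $c_1=0$ add $\binom{p_0+c_0}{p-h_0}\binom{p_1+c_1}{q-h_1}$ to $cnt$, otherwise add $\binom{p_0+c_0}{p-h_0}\binom{p_1}{q-h_1}+\binom{p_0}{p-h_0}\binom{p_1+c_1}{q-h_1}-\binom{p_0}{p-h_0}\binom{p_1}{q-h_1}$; return. (2) Move every node of $C_U$ adjacent to all of $C_V$ into $P_U$; then move every node of $C_V$ adjacent to all of the updated $C_U$ into $P_V$. (3) Minimum non-neighbor candidate partition: let $w\in C_U\cup C_V$ minimize $\min(|C_U\setminus N(w)|,|C_V\setminus N(w)|)$; if $|C_U\setminus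 N(w)|\le|C_V\setminus N(w)|$ set $L_U=C_U\setminus N(w)$, $L_V=\emptyset$, else $L_U=\emptyset$, $L_V=C_V\setminus N(w)$. (4) For each $u\in L_U$ in turn: $C_U\gets C_U\setminus\{u\}$, call NPC$(C_U,C_V\cap N(u),P_U,P_V,H_U\cup\{u\},H_V)$. (5) For each $v\in L_V$ in turn: $C_V\gets C_V\setminus\{v\}$, call NPC$(C_U\cap N(v),C_V,P_U,P_V,H_U,H_V\cup\{v\})$. (6) Call NPC$(C_U,C_V,P_U,P_V,H_U,H_V)$ with the current sets. NPivoter: set $cnt\gets0$. For each $u\in U$: if $s(u)=\text{edge}$, for each $v\in N(u)$ call NPC$(\{u'\in N(v):R(u')>R(u)\},\{v'\in N(u):R(v')>R(v)\},\emptyset,\emptyset,\{u\},\{v\})$; if $s(u)=\text{node}$, call NPC$(\{u'\in U:R(u')>R(u),\,N(u')\cap N(u)\neq\emptyset\},N(u),\emptyset,\emptyset,\{u\},\emptyset)$. Return $cnt$.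
   Formalization: It is assumed that E is nonempty and |U| ≤ K|E| for some K, with the O-constant depending only on K; otherwise the claim is false: a single edge plus many isolated vertices in U forces at least |U| steps of the loop over U, while the bound stays constant. *)

theory Defs
  imports Complex_Main "HOL-Library.Product_Plus"
begin

section \<open>Bipartite graphs\<close>

locale bipartite_graph =
  fixes U V :: "'a set" and E :: "('a \<times> 'a) set"
  assumes finite_U: "finite U" and finite_V: "finite V"
    and disjoint: "U \<inter> V = {}"
    and edges: "E \<subseteq> U \<times> V"

text \<open>An edge is stored once, as a pair whose first component lies in \<open>U\<close>, so \<open>card E\<close> is the
  number of edges; adjacency is symmetric.\<close>

definition nbrs :: "('a \<times> 'a) set \<Rightarrow> 'a \<Rightarrow> 'a set" where
  "nbrs E x = {y. (x, y) \<in> E \<or> (y, x) \<in> E}"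

definition n_max :: "'a set \<Rightarrow> 'a set \<Rightarrow> ('a \<times> 'a) set \<Rightarrow> nat" where
  "n_max U V E = Max ((\<lambda>u. card (nbrs E u)) ` U) + Max ((\<lambda>v. card (nbrs E v)) ` V)"

section \<open>The algorithm\<close>

text \<open>Binomial coefficients vanish for a negative lower index.\<close>

definition binom :: "nat \<Rightarrow> int \<Rightarrow> int" where
  "binom n k = (if k < 0 then 0 else int (n choose nat k))"

datatype split = Node | Edge

text \<open>The arguments \<open>(C_U, C_V, P_U, P_V, H_U, H_V)\<close> of a call of \<open>NPC\<close>.\<close>

type_synonym 'a config = "'a set \<times> 'a set \<times> 'a set \<times> 'a set \<times> 'a set \<times> 'a set"

text \<open>The procedure leaves open which minimizer \<open>w\<close> is taken and in which order the loops run
  through \<open>L_U\<close> and \<open>L_V\<close>. The parameters \<open>pick\<close> and \<open>enum\<close> resolve these choices; they are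
  arbitrary and may depend on the arguments of the call in which the choice is made.\<close>

locale npivoter = bipartite_graph U V E
  for U V :: "'a set" and E :: "('a \<times> 'a) set" +
  fixes p q :: nat
    and R :: "'a \<Rightarrow> nat"
    and s :: "'a \<Rightarrow> split"
    and pick :: "'a config \<Rightarrow> 'a set \<Rightarrow> 'a"
    and enum :: "'a config \<Rightarrow> 'a set \<Rightarrow> 'a list"
  assumes p_pos: "0 < p" and q_pos: "0 < q"
    and ranking: "inj_on R (U \<union> V)"
    and pick: "M \<noteq> {} \<Longrightarrow> pick c M \<in> M"
    and enum: "finite L \<Longrightarrow> set (enum c L) = L \<and> distinct (enum c L)"
begin

abbreviation N :: "'a \<Rightarrow> 'a set" where
  "N \<equiv> nbrs E"

definition min_nonnbr :: "'a set \<Rightarrow> 'a set \<Rightarrow> 'a set" where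
  "min_nonnbr CU CV =
    {w. is_arg_min (\<lambda>x. min (card (CU - N x)) (card (CV - N x))) (\<lambda>x. x \<in> CU \<union> CV) w}"

definition leaf_count :: "'a config \<Rightarrow> int" where
  "leaf_count = (\<lambda>(CU, CV, PU, PV, HU, HV).
    let c0 = card CU; c1 = card CV; p0 = card PU; p1 = card PV;
        a = int p - int (card HU); b = int q - int (card HV)
    in if c0 = 0 \<or> c1 = 0
       then binom (p0 + c0) a * binom (p1 + c1) b
       else binom (p0 + c0) a * binom p1 b + binom p0 a * binom (p1 + c1) b
            - binom p0 a * binom p1 b)"

text \<open>
  \<open>NPC\<close> returns a pair: the amount added to the global counter \<open>cnt\<close>, and the number of time units
  used. Pairs are added componentwise (theory \<open>Product_Plus\<close>), so the sums below accumulate both.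

  Cost model. Unit cost: an arithmetic operation or binomial coefficient; an adjacency test, a
  comparison of ranks, or a cardinality look-up; visiting, inserting or deleting one element of a
  set. A bounded number of such operations counts as one unit. Every search is charged as an
  exhaustive scan:
    \<^item> step (1) tests all pairs in \<open>C_U \<times> C_V\<close>; the rest of a terminating call is one unit;
    \<^item> step (2) tests \<open>C_U \<times> C_V\<close>, then the updated \<open>C_U\<close> against \<open>C_V\<close>, and moves elements one by one;
    \<^item> step (3) tests every candidate against every candidate, and then builds \<open>L_U\<close> or \<open>L_V\<close>;
    \<^item> in steps (4) and (5) an iteration makes one deletion and one insertion, and builds the two
      candidate sets of the recursive call (which are modified there) by running through the current
      \<open>C_U\<close> and \<open>C_V\<close>;
    \<^item> step (6) hands over the current sets, one unit.
  The sets \<open>P_U\<close>, \<open>P_V\<close>, \<open>H_U\<close>, \<open>H_V\<close> only grow along a chain of calls and only their sizes are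
  inspected, so they are passed on by reference with their size, without being copied.

  The outer conditional states the precondition \<open>C_U \<subseteq> U\<close>, \<open>C_V \<subseteq> V\<close>, which \<open>NPivoter\<close> establishes
  and recursive calls preserve. If step (2) empties \<open>C_U\<close> and \<open>C_V\<close>, there is no candidate \<open>w\<close>; then
  \<open>L_U = L_V = {}\<close> whatever \<open>pick\<close> returns, and only step (6) is executed.
\<close>

function NPC ::
  "'a set \<Rightarrow> 'a set \<Rightarrow> 'a set \<Rightarrow> 'a set \<Rightarrow> 'a set \<Rightarrow> 'a set \<Rightarrow> int \<times> nat" where
  "NPC CU CV PU PV HU HV =
    (if \<not> (CU \<subseteq> U \<and> CV \<subseteq> V) then undefined
     else if (\<forall>u\<in>CU. \<forall>v\<in>CV. v \<notin> N u) \<or> card HU = p \<or> card HV = q then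
       (leaf_count (CU, CV, PU, PV, HU, HV), card CU * card CV + 1)
     else
       let cfg = (CU, CV, PU, PV, HU, HV);
           AU = {u \<in> CU. CV \<subseteq> N u};
           CU' = CU - AU; PU' = PU \<union> AU;
           AV = {v \<in> CV. CU' \<subseteq> N v};
           CV' = CV - AV; PV' = PV \<union> AV;
           w = pick cfg (min_nonnbr CU' CV');
           left = (card (CU' - N w) \<le> card (CV' - N w));
           LU = (if left then CU' - N w else {});
           LV = (if left then {} else CV' - N w);
           us = enum cfg LU;
           vs = enum cfg LV
       in (0, card CU * card CV + 1)
          + (0, card CU * card CV + card AU + card CU' * card CV + card AV)
          + (0, (card CU' + card CV')\<^sup>2 + card CU' + card CV')
          + (\<Sum>i<length us.
               (let C = CU' - set (take (Suc i) us); u = us ! i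
                in (0, card C + card CV' + 1)
                   + NPC C (CV' \<inter> N u) PU' PV' (HU \<union> {u}) HV))
          + (\<Sum>i<length vs.
               (let C = CV' - set (take (Suc i) vs); v = vs ! i
                in (0, card (CU' - LU) + card C + 1)
                   + NPC ((CU' - LU) \<inter> N v) C PU' PV' HU (HV \<union> {v})))
          + (0, 1) + NPC (CU' - LU) (CV' - LV) PU' PV' HU HV)"
  by pat_completeness auto

lemma nonnbr_nonempty:
  assumes "finite CU" "finite CV" "CU \<subseteq> U" "CV \<subseteq> V" "CU \<noteq> {} \<or> CV \<noteq> {}"
    "\<And>u. u \<in> CU \<Longrightarrow> \<not> CV \<subseteq> N u" "\<And>v. v \<in> CV \<Longrightarrow> \<not> CU \<subseteq> N v"
    "w = pick c (min_nonnbr CU CV)"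
  shows "CU - N w \<noteq> {}" "CV - N w \<noteq> {}"
proof -
  have "\<exists>x. is_arg_min (\<lambda>x. min (card (CU - N x)) (card (CV - N x))) (\<lambda>x. x \<in> CU \<union> CV) x"
    using ex_is_arg_min_if_finite[of "CU \<union> CV"] assms by auto
  then have "min_nonnbr CU CV \<noteq> {}"
    by (auto simp: min_nonnbr_def)
  then have "w \<in> min_nonnbr CU CV"
    using pick assms(8) by metis
  then have "w \<in> CU \<union> CV"
    by (simp add: min_nonnbr_def is_arg_min_def)
  then consider "w \<in> CU" | "w \<in> CV" by blast
  then have "CU - N w \<noteq> {} \<and> CV - N w \<noteq> {}"
  proof cases
    case 1
    then have "w \<notin> N w"
      using edges disjoint assms(3) by (auto simp: nbrs_def)
    then show ?thesis
      using 1 assms(6)[OF 1] by blast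
  next
    case 2
    then have "w \<notin> N w"
      using edges disjoint assms(4) by (auto simp: nbrs_def)
    then show ?thesis
      using 2 assms(7)[OF 2] by blast
  qed
  then show "CU - N w \<noteq> {}" "CV - N w \<noteq> {}" by auto
qed

lemma card_Int_Diff_less:
  assumes "finite A" "A' \<subseteq> A" "x \<in> X" "x \<in> A'" "finite B" "B' \<subseteq> B"
  shows "card (A' - X) + card (B' \<inter> Y) < card A + card B"
proof -
  have "card (A' - X) < card A"
    using assms by (intro psubset_card_mono) auto
  moreover have "card (B' \<inter> Y) \<le> card B"
    using assms by (intro card_mono) auto
  ultimately show ?thesis by simp
qed

termination NPC
proof (relation "measure (\<lambda>(CU, CV, PU, PV, HU, HV). card CU + card CV)", goal_cases)
  case (2 CU CV PU PV HU HV cfg AU CU' PU' AV CV' PV' w left LU LV us vs i C u)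
  have fin: "finite CU" "finite CV"
    using 2(1) finite_U finite_V finite_subset by blast+
  then have "set us \<subseteq> CU'"
    using 2(5,12,14) enum[of LU cfg] by (auto split: if_splits)
  moreover have "u \<in> set us" "u \<in> set (take (Suc i) us)"
    using 2(16,18) by (auto simp: in_set_conv_nth intro!: exI[of _ i])
  ultimately have "card (CU' - set (take (Suc i) us)) + card (CV' \<inter> N u) < card CU + card CV"
    using fin 2(5,8) by (intro card_Int_Diff_less[where x = u]) auto
  then show ?case
    unfolding 2(17) by simp
next
  case (3 CU CV PU PV HU HV cfg AU CU' PU' AV CV' PV' w left LU LV us vs i C v)
  have fin: "finite CU" "finite CV"
    using 3(1) finite_U finite_V finite_subset by blast+
  then have "set vs \<subseteq> CV'"
    using 3(8,13,15) enum[of LV cfg] by (auto split: if_splits)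
  moreover have "v \<in> set vs" "v \<in> set (take (Suc i) vs)"
    using 3(16,18) by (auto simp: in_set_conv_nth intro!: exI[of _ i])
  ultimately have "card (CV' - set (take (Suc i) vs)) + card ((CU' - LU) \<inter> N v) < card CV + card CU"
    using fin 3(5,8) by (intro card_Int_Diff_less[where x = v]) auto
  then show ?case
    unfolding 3(17) by simp
next
  case (4 CU CV PU PV HU HV cfg AU CU' PU' AV CV' PV' w left LU LV us vs)
  have fin: "finite CU" "finite CV"
    using 4(1) finite_U finite_V finite_subset by blast+
  have "(CU' - LU) \<union> (CV' - LV) \<subset> CU \<union> CV"
  proof (cases "CU' = {} \<and> CV' = {}")
    case True
    then show ?thesis using 4(2) by auto
  next
    case False
    have cand: "CU' \<subseteq> CU" "CV' \<subseteq> CV" "CU \<subseteq> U" "CV \<subseteq> V"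
      using 4(1,5,8) by auto
    then have "finite CU'" "finite CV'" "CU' \<subseteq> U" "CV' \<subseteq> V"
      using fin finite_subset by auto
    moreover have "\<not> CV' \<subseteq> N u" if "u \<in> CU'" for u
    proof -
      obtain x where x: "x \<in> CV" "x \<notin> N u"
        using \<open>u \<in> CU'\<close> unfolding 4(5) 4(4) by blast
      then have "u \<notin> N x"
        by (auto simp: nbrs_def)
      then have "x \<in> CV'"
        using x(1) \<open>u \<in> CU'\<close> unfolding 4(8) 4(7) by blast
      then show ?thesis
        using x(2) by blast
    qed
    moreover have "\<not> CU' \<subseteq> N v" if "v \<in> CV'" for v
      using that 4(7,8) by auto
    ultimately have ne: "CU' - N w \<noteq> {}" "CV' - N w \<noteq> {}"
      using nonnbr_nonempty[of CU' CV' w cfg] False 4(10) by auto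
    have "CU' \<inter> CV' = {}"
      using cand disjoint by blast
    then have "(CU' - LU) \<union> (CV' - LV) \<noteq> CU' \<union> CV'"
      using ne unfolding 4(12,13) by (cases left) (simp, blast, simp, blast)
    then show ?thesis
      using cand by blast
  qed
  then have "card ((CU' - LU) \<union> (CV' - LV)) < card (CU \<union> CV)"
    using fin by (intro psubset_card_mono) auto
  moreover have "CU \<inter> CV = {}" "(CU' - LU) \<inter> (CV' - LV) = {}"
    using 4(1) disjoint unfolding 4(5) 4(8) by blast+
  ultimately show ?case
    using fin 4(5,8) by (simp add: card_Un_disjoint)
qed simp

text \<open>
  Initial calls. For an edge \<open>(u, v)\<close> the candidate sets are filtered out of \<open>N(v)\<close> and \<open>N(u)\<close>. For
  node splitting, \<open>C_U\<close> is collected by running through the adjacency list of every \<open>v \<in> N(u)\<close>, and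
  \<open>C_V\<close> is a copy of \<open>N(u)\<close>. The order of the loops over \<open>U\<close> and \<open>N(u)\<close> affects neither the
  final value of \<open>cnt\<close> nor the total time, so they are written as sums.
\<close>

definition NPivoter :: "int \<times> nat" where
  "NPivoter =
    (0, 1) +
    (\<Sum>u\<in>U. (0, 1) +
      (case s u of
        Edge \<Rightarrow>
          (\<Sum>v\<in>N u. (0, card (N v) + card (N u) + 1)
             + NPC {u' \<in> N v. R u < R u'} {v' \<in> N u. R v < R v'} {} {} {u} {v})
      | Node \<Rightarrow>
          (0, (\<Sum>v\<in>N u. card (N v)) + card (N u) + 1)
             + NPC {u' \<in> U. R u < R u' \<and> N u' \<inter> N u \<noteq> {}} (N u) {} {} {u} {}))"

definition running_time :: nat where
  "running_time = snd NPivoter"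

end

end

theory Submission
  imports Defs
begin

text \<open>
  Let \<open>n\<close> candidates survive step (2) of a call, and let \<open>k \<ge> 1\<close> be the minimum number of
  non-neighbours. The \<open>i\<close>-th call of a loop loses \<open>i\<close> candidates on the branching side and, by
  minimality of \<open>k\<close>, at least \<open>k\<close> on the other side. The call of step (6) loses the \<open>k\<close> branching
  candidates, and its own step (2) then also removes the pivot. So
  \<open>T(n) \<le> (\<Sum>i=1..k. T(n - k - i)) + T(n - k - 1) + poly(n)\<close>, whose solution is \<open>O(2 powr (n / 2))\<close>;
  the worst case is \<open>k = 1\<close>. An edge-split root has at most \<open>n_max\<close> candidates. At a node-split root
  \<open>C_U\<close> may be larger, but every candidate in \<open>V\<close> has few neighbours in \<open>C_U\<close>, so after one branching
  step the sizes are again bounded by \<open>n_max\<close>.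
\<close>

section \<open>The branching recurrence\<close>

text \<open>The cubic term pays for the at most \<open>m + 1\<close> recursive calls that a call with \<open>m\<close> surviving
  candidates makes, each of which costs at most \<open>6 * (m + 1)\<^sup>2\<close> by itself.\<close>

fun call_bound :: "nat \<Rightarrow> real" where
  "call_bound 0 = 6"
| "call_bound (Suc m) = sqrt 2 * call_bound m + 6 * (real m + 2) ^ 3"

lemma call_bound_ge: "6 \<le> call_bound m"
proof (induction m)
  case (Suc m)
  have "1 * call_bound m \<le> sqrt 2 * call_bound m"
    using Suc by (intro mult_right_mono) auto
  moreover have "0 \<le> 6 * (real m + 2) ^ 3"
    by simp
  ultimately show ?case
    using Suc unfolding call_bound.simps by linarith
qed simp

text \<open>Unroll the recurrence \<open>j\<close> times and drop the polynomial terms.\<close>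

lemma call_bound_add: "sqrt 2 ^ j * call_bound m \<le> call_bound (m + j)"
proof (induction j)
  case (Suc j)
  have "sqrt 2 ^ Suc j * call_bound m \<le> sqrt 2 * call_bound (m + j)"
    using mult_left_mono[OF Suc, of "sqrt 2"] by (simp add: mult.assoc)
  moreover have "0 \<le> 6 * (real (m + j) + 2) ^ 3"
    by simp
  ultimately show ?case
    unfolding add_Suc_right call_bound.simps by linarith
qed simp

lemma call_bound_mono: "m \<le> n \<Longrightarrow> call_bound m \<le> call_bound n"
proof -
  assume "m \<le> n"
  have "1 * call_bound m \<le> sqrt 2 ^ (n - m) * call_bound m"
    using call_bound_ge[of m] by (intro mult_right_mono) auto
  then show ?thesis
    using call_bound_add[of "n - m" m] \<open>m \<le> n\<close> by simp
qed

text \<open>When the recurrence is unrolled from \<open>m - j\<close> up to \<open>m\<close>, the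
  polynomial term is kept only in the last step. The reserve \<open>6 * (m + 1) ^ 3\<close> kept
  there pays for the quadratic costs in \<open>call_bound_step\<close>.\<close>

lemma call_bound_diff:
  assumes "1 \<le> j" "j \<le> m"
  shows "call_bound (m - j) \<le> (call_bound m - 6 * (real m + 1) ^ 3) / sqrt 2 ^ j"
proof -
  obtain i where i: "j = Suc i"
    using assms by (cases j) auto
  obtain l where l: "m = Suc (l + i)"
    using assms i by (metis le_add_diff_inverse2 add_Suc_right)
  have "sqrt 2 * (sqrt 2 ^ i * call_bound l) \<le> sqrt 2 * call_bound (l + i)"
    by (intro mult_left_mono call_bound_add) simp
  also have "\<dots> = call_bound m - 6 * (real m + 1) ^ 3"
    by (simp add: l add.commute)
  finally have "sqrt 2 ^ j * call_bound (m - j) \<le> call_bound m - 6 * (real m + 1) ^ 3"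
    by (simp add: i l mult.assoc)
  then show ?thesis
    by (simp add: field_simps)
qed

text \<open>Equality for \<open>k = 1\<close>: this case determines the base \<open>sqrt 2\<close>.\<close>

lemma branching_sum_le:
  assumes "1 \<le> k"
  shows "(\<Sum>i<k. 1 / sqrt 2 ^ Suc i) + 1 / sqrt 2 \<le> sqrt 2 ^ k"
  using assms
proof (induction k rule: nat_induct_at_least)
  case base
  have "1 / sqrt 2 + 1 / sqrt 2 = sqrt (2::real)"
    by (simp add: real_div_sqrt)
  then show ?case
    by simp
next
  case (Suc k)
  \<comment> \<open>Passing from \<open>k\<close> to \<open>Suc k\<close> adds
    \<open>1 / sqrt 2 ^ Suc k\<close> on the left and \<open>sqrt 2 ^ k * (sqrt 2 - 1)\<close> on
    the right. The ratio of the right increment to the left one is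
    \<open>sqrt 2 ^ (2 * k + 1) * (sqrt 2 - 1)\<close>, which is smallest at \<open>k = 1\<close>,
    where it is \<open>4 - 2 * sqrt 2\<close>.\<close>
  have "1 \<le> (sqrt 2) ^ 3 * (sqrt 2 - 1 :: real)"
  proof -
    have "(sqrt 2) ^ 3 * (sqrt 2 - 1 :: real) = 4 - 2 * sqrt 2"
      by (simp add: algebra_simps power3_eq_cube)
    moreover have "sqrt 2 \<le> (3 / 2 :: real)"
      by (rule real_le_lsqrt) (auto simp: power2_eq_square)
    ultimately show ?thesis
      by simp
  qed
  also have "\<dots> \<le> sqrt 2 ^ (Suc k + k) * (sqrt 2 - 1)"
    using Suc.hyps by (intro mult_right_mono power_increasing) auto
  finally have "1 / sqrt 2 ^ Suc k \<le> sqrt 2 ^ k * (sqrt 2 - 1)"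
    by (simp only: power_add) (simp add: field_simps)
  then show ?case
    using Suc.IH by (simp add: algebra_simps)
qed

text \<open>The exponential parts of the \<open>k\<close> loop calls and of the step (6) call sum to
  at most \<open>Q\<close> by \<open>branching_sum_le\<close>. The \<open>k + 1 \<le> m + 1\<close>
  quadratic terms fit into the cubic reserve that separates \<open>Q\<close> from
  \<open>call_bound m\<close>.\<close>

lemma call_bound_step:
  assumes "1 \<le> k" "2 * k \<le> m"
  shows "(\<Sum>i<k. 6 * (real m + 1)\<^sup>2 + call_bound (m - (k + Suc i))) + 6 * (real m + 1)\<^sup>2
    + call_bound (m - (k + 1)) \<le> call_bound m"
proof -
  define Q where "Q = call_bound m - 6 * (real m + 1) ^ 3"
  have "0 \<le> sqrt 2 * call_bound (m - 1)"
    using call_bound_ge[of "m - 1"] by simp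
  then have Q: "0 \<le> Q"
    using assms by (cases m) (auto simp: Q_def add.commute)
  have "(\<Sum>i<k. call_bound (m - (k + Suc i))) + call_bound (m - (k + 1))
    \<le> (\<Sum>i<k. Q / sqrt 2 ^ (k + Suc i)) + Q / sqrt 2 ^ (k + 1)"
    unfolding Q_def using assms by (intro add_mono sum_mono call_bound_diff) auto
  also have "\<dots> = Q / sqrt 2 ^ k * ((\<Sum>i<k. 1 / sqrt 2 ^ Suc i) + 1 / sqrt 2)"
    by (simp add: power_add sum_distrib_left distrib_left mult_ac)
  also have "\<dots> \<le> Q / sqrt 2 ^ k * sqrt 2 ^ k"
    using Q assms by (intro mult_left_mono branching_sum_le) auto
  finally have *: "(\<Sum>i<k. call_bound (m - (k + Suc i))) + call_bound (m - (k + 1)) \<le> Q"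
    by simp
  have "(real k + 1) * (6 * (real m + 1)\<^sup>2) \<le> (real m + 1) * (6 * (real m + 1)\<^sup>2)"
    using assms by (intro mult_right_mono) auto
  then show ?thesis
    using * by (simp add: Q_def sum.distrib power2_eq_square power3_eq_cube algebra_simps)
qed

section \<open>Absorbing polynomial terms into powers of \<open>sqrt 2\<close>\<close>

lemma poly_le_sqrt2_power: "\<exists>B. \<forall>n. (real n + 1) ^ k \<le> B * sqrt 2 ^ n"
proof -
  \<comment> \<open>Since \<open>y ^ k \<le> y ^ Suc k = sqrt 2\<close>, a linear bound
    \<open>n + 1 \<le> c * y ^ n\<close> raised to the power \<open>k\<close> suffices. The root of
    order \<open>Suc k\<close> makes sense for \<open>k = 0\<close> as well.\<close>
  define y where "y = root (Suc k) (sqrt 2)"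
  have "1 < y"
    by (simp add: y_def)
  have y: "y ^ Suc k = sqrt 2"
    unfolding y_def by (intro real_root_pow_pos2) auto
  \<comment> \<open>\<open>c \<ge> 1\<close> starts the induction, and
    \<open>c * (y - 1) \<ge> 1\<close> makes \<open>c * y ^ n\<close> grow by at least 1 per
    step.\<close>
  define c where "c = max 1 (1 / (y - 1))"
  have c: "1 \<le> c" "1 \<le> c * (y - 1)"
    using \<open>1 < y\<close> by (auto simp: c_def max_def field_simps)
  have *: "real n + 1 \<le> c * y ^ n" for n
  proof (induction n)
    case (Suc n)
    have "1 * 1 \<le> c * (y - 1) * y ^ n"
      using c \<open>1 < y\<close> by (intro mult_mono) auto
    then show ?case
      using Suc by (simp add: algebra_simps)
  qed (use c in simp)
  have "(real n + 1) ^ k \<le> c ^ k * sqrt 2 ^ n" for n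
  proof -
    have "(real n + 1) ^ k \<le> (c * y ^ n) ^ k"
      using * by (intro power_mono) auto
    also have "\<dots> = c ^ k * (y ^ k) ^ n"
      by (simp add: power_mult_distrib power_mult[symmetric] mult.commute)
    also have "\<dots> \<le> c ^ k * (y ^ Suc k) ^ n"
      using c \<open>1 < y\<close> by (intro mult_left_mono power_mono power_increasing) auto
    finally show ?thesis
      by (simp only: y)
  qed
  then show ?thesis
    by blast
qed

text \<open>Divided by \<open>sqrt 2 ^ m\<close>, the cubic terms of the recurrence form a
  convergent series, so no polynomial factor remains in the bound.\<close>

lemma call_bound_exp: "\<exists>B. \<forall>m. 6 * (real m + 1)\<^sup>2 + call_bound m \<le> B * sqrt 2 ^ m"
proof -
  obtain B5 where B5: "\<And>n. (real n + 1) ^ 5 \<le> B5 * sqrt 2 ^ n"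
    using poly_le_sqrt2_power by metis
  obtain B2 where B2: "\<And>n. (real n + 1) ^ 2 \<le> B2 * sqrt 2 ^ n"
    using poly_le_sqrt2_power by metis
  have "1 \<le> B5"
    using B5[of 0] by simp
  \<comment> \<open>The factor \<open>12 - 6 / (m + 1)\<close> is 6 at \<open>m = 0\<close>, like
    \<open>call_bound 0\<close>, and stays below 12. Using \<open>B5\<close> for the fifth power
    instead of the cube gains the divisor \<open>(m + 2) ^ 2\<close>, which lets the added terms
    telescope.\<close>
  have *: "call_bound m \<le> B5 * (12 - 6 / (real m + 1)) * sqrt 2 ^ m" for m
  proof (induction m)
    case (Suc m)
    have "6 * (real m + 2) ^ 3 = 6 * (real m + 2) ^ 5 / (real m + 2) ^ 2"
      by (simp add: field_simps power_add[symmetric])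
    also have "\<dots> \<le> 6 * (B5 * sqrt 2 ^ Suc m) / (real m + 2) ^ 2"
      using B5[of "Suc m"] by (intro divide_right_mono mult_left_mono) (auto simp: add.commute)
    also have "\<dots> \<le> 6 * (B5 * sqrt 2 ^ Suc m) / ((real m + 1) * (real m + 2))"
      using \<open>1 \<le> B5\<close> by (intro divide_left_mono) (auto simp: power2_eq_square)
    also have "\<dots> = B5 * (6 / (real m + 1) - 6 / (real m + 2)) * sqrt 2 ^ Suc m"
      by (simp add: field_simps)
    finally have "6 * (real m + 2) ^ 3 \<le> B5 * (6 / (real m + 1) - 6 / (real m + 2)) * sqrt 2 ^ Suc m" .
    moreover have "sqrt 2 * call_bound m \<le> B5 * (12 - 6 / (real m + 1)) * sqrt 2 ^ Suc m"
      using mult_left_mono[OF Suc, of "sqrt 2"] by (simp add: mult_ac)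
    ultimately have "call_bound (Suc m) \<le> B5 * (12 - 6 / (real m + 1)) * sqrt 2 ^ Suc m
        + B5 * (6 / (real m + 1) - 6 / (real m + 2)) * sqrt 2 ^ Suc m"
      unfolding call_bound.simps by linarith
    also have "\<dots> = B5 * (12 - 6 / (real (Suc m) + 1)) * sqrt 2 ^ Suc m"
      by (simp add: algebra_simps)
    finally show ?case .
  qed (use \<open>1 \<le> B5\<close> in simp)
  have "6 * (real m + 1)\<^sup>2 + call_bound m \<le> (6 * B2 + 12 * B5) * sqrt 2 ^ m" for m
  proof -
    have "B5 * (12 - 6 / (real m + 1)) * sqrt 2 ^ m \<le> B5 * 12 * sqrt 2 ^ m"
      using \<open>1 \<le> B5\<close> by (intro mult_right_mono mult_left_mono) auto
    then show ?thesis
      using *[of m] B2[of m] by (simp add: algebra_simps)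
  qed
  then show ?thesis
    by blast
qed

text \<open>The infinite series has the sum \<open>1 / (sqrt 2 - 1) = sqrt 2 + 1\<close>;
  \<open>5 / 2\<close> is a rational bound for it, obtained from
  \<open>7 / 5 \<le> sqrt 2\<close>.\<close>

lemma geometric_sum_le: "(\<Sum>i<k. 1 / sqrt 2 ^ Suc i) \<le> 5 / 2"
proof -
  have "(\<Sum>i<k. 1 / sqrt 2 ^ Suc i) * (sqrt 2 - 1) = 1 - 1 / sqrt (2::real) ^ k"
    by (induction k) (auto simp: field_simps)
  also have "\<dots> \<le> 5 / 2 * (7 / 5 - 1)"
    by simp
  also have "\<dots> \<le> 5 / 2 * (sqrt 2 - 1)"
  proof -
    have "7 / 5 \<le> sqrt (2::real)"
      by (rule real_le_rsqrt) (simp add: power2_eq_square)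
    then show ?thesis by simp
  qed
  finally show ?thesis
    by (rule mult_right_le_imp_le) simp
qed

section \<open>The cost of one call\<close>

context npivoter
begin

declare NPC.simps [simp del]

abbreviation time :: "'a set \<Rightarrow> 'a set \<Rightarrow> 'a set \<Rightarrow> 'a set \<Rightarrow> 'a set \<Rightarrow> 'a set \<Rightarrow> nat" where
  "time CU CV PU PV HU HV \<equiv> snd (NPC CU CV PU PV HU HV)"

text \<open>The candidates that survive step (2).\<close>

definition core_U :: "'a set \<Rightarrow> 'a set \<Rightarrow> 'a set" where
  "core_U CU CV = CU - {u \<in> CU. CV \<subseteq> N u}"

definition core_V :: "'a set \<Rightarrow> 'a set \<Rightarrow> 'a set" where
  "core_V CU CV = CV - {v \<in> CV. core_U CU CV \<subseteq> N v}"

lemma core_subset: "core_U CU CV \<subseteq> CU" "core_V CU CV \<subseteq> CV"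
  by (auto simp: core_U_def core_V_def)

lemma nbrs_sym: "x \<in> N y \<longleftrightarrow> y \<in> N x"
  by (auto simp: nbrs_def)

text \<open>Step (2) treats \<open>V\<close> after \<open>U\<close>. A non-neighbour of
  \<open>u\<close> in \<open>CV\<close> is not adjacent to the survivor \<open>u\<close>, so the
  second half of the step keeps it. Hence one pass leaves no fully adjacent candidate on either
  side.\<close>

lemma core_U_nonnbr: "u \<in> core_U CU CV \<Longrightarrow> \<not> core_V CU CV \<subseteq> N u"
proof -
  assume u: "u \<in> core_U CU CV"
  then obtain x where x: "x \<in> CV" "x \<notin> N u"
    unfolding core_U_def by blast
  then have "x \<in> core_V CU CV"
    using u nbrs_sym unfolding core_V_def by blast
  then show ?thesis
    using x(2) by blast
qed

lemma core_V_nonnbr: "v \<in> core_V CU CV \<Longrightarrow> \<not> core_U CU CV \<subseteq> N v"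
  by (simp add: core_V_def)

lemma finite_subset_UV: "A \<subseteq> U \<Longrightarrow> finite A" "B \<subseteq> V \<Longrightarrow> finite B"
  using finite_U finite_V finite_subset by blast+

lemma min_nonnbr_nonempty:
  assumes "finite CU" "finite CV" "CU \<union> CV \<noteq> {}"
  shows "min_nonnbr CU CV \<noteq> {}"
  using ex_is_arg_min_if_finite[of "CU \<union> CV"] assms by (auto simp: min_nonnbr_def)

text \<open>The own work of a non-terminating call: \<open>a\<close>, \<open>b\<close> count the
  candidates, \<open>a'\<close>, \<open>b'\<close> the survivors of step (2), \<open>c\<close>,
  \<open>d\<close> the moved nodes, \<open>k\<close> the loop iterations, and \<open>L\<close> is
  the cost of preparing the loop calls. With \<open>n = a + b\<close>, five terms are at most
  \<open>n ^ 2\<close> each and the rest is linear.\<close>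

lemma call_cost_le:
  fixes a b a' b' c d k L :: nat
  assumes "a' \<le> a" "b' \<le> b" "c \<le> a" "d \<le> b" "k \<le> a + b" "L \<le> k * (a + b)"
  shows "a * b + 1 + (a * b + c + a' * b + d) + ((a' + b')\<^sup>2 + a' + b') + L + 1
    \<le> 6 * (a + b + 1)\<^sup>2"
proof -
  define n where "n = a + b"
  have le: "a \<le> n" "b \<le> n" "a' \<le> n" "a' + b' \<le> n" "c + d \<le> n" "k \<le> n"
    using assms by (auto simp: n_def)
  then have "a * b \<le> n * n" "a' * b \<le> n * n" "(a' + b') * (a' + b') \<le> n * n" "L \<le> n * n"
    using assms(6) unfolding n_def[symmetric]
    by (auto intro: mult_le_mono order_trans[OF _ mult_le_mono1])
  then show ?thesis
    using le unfolding n_def[symmetric] by (simp add: power2_eq_square)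
qed

text \<open>\<open>f\<close> is an arbitrary bound for the recursive calls. The case \<open>leaf\<close> also covers a step (2)
  that leaves no candidates.\<close>

lemma NPC_time_cases:
  fixes f :: "'a set \<Rightarrow> 'a set \<Rightarrow> real"
  assumes CU: "CU \<subseteq> U" and CV: "CV \<subseteq> V"
    and IH: "\<forall>X Y PU PV HU HV. X \<subseteq> CU \<longrightarrow> Y \<subseteq> CV \<longrightarrow> card X + card Y < card CU + card CV \<longrightarrow>
      real (time X Y PU PV HU HV) \<le> f X Y"
    and A: "A = core_U CU CV" and B: "B = core_V CU CV"
    and cost: "cost = 6 * (real (card CU + card CV) + 1)\<^sup>2"
  obtains
    (leaf) "real (time CU CV PU PV HU HV) \<le> cost + 1"
  | (left) w us where "w \<in> A \<union> B" "distinct us" "us \<noteq> []" "set us = A - N w"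
      "\<And>x. x \<in> A \<union> B \<Longrightarrow> length us \<le> card (A - N x) \<and> length us \<le> card (B - N x)"
      "real (time CU CV PU PV HU HV) \<le> cost
        + (\<Sum>i<length us. f (A - set (take (Suc i) us)) (B \<inter> N (us ! i))) + f (A - set us) B"
  | (right) w vs where "w \<in> A \<union> B" "distinct vs" "vs \<noteq> []" "set vs = B - N w"
      "\<And>x. x \<in> A \<union> B \<Longrightarrow> length vs \<le> card (A - N x) \<and> length vs \<le> card (B - N x)"
      "real (time CU CV PU PV HU HV) \<le> cost
        + (\<Sum>i<length vs. f (A \<inter> N (vs ! i)) (B - set (take (Suc i) vs))) + f A (B - set vs)"
proof (cases "(\<forall>u\<in>CU. \<forall>v\<in>CV. v \<notin> N u) \<or> card HU = p \<or> card HV = q")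
  case True
  have "card CU * card CV \<le> (card CU + card CV)\<^sup>2"
    by (simp add: power2_eq_square algebra_simps)
  then have "real (card CU * card CV) \<le> cost"
    unfolding cost of_nat_le_iff[where 'a = real, symmetric] by (simp add: power2_eq_square algebra_simps)
  moreover have "time CU CV PU PV HU HV = card CU * card CV + 1"
    using True CU CV by (subst NPC.simps) simp
  ultimately have "real (time CU CV PU PV HU HV) \<le> cost + 1"
    by simp
  then show thesis by (rule leaf)
next
  case nonleaf: False
  define cfg where "cfg = (CU, CV, PU, PV, HU, HV)"
  define AU where "AU = {u \<in> CU. CV \<subseteq> N u}"
  define AV where "AV = {v \<in> CV. A \<subseteq> N v}"
  define PU' where "PU' = PU \<union> AU"
  define PV' where "PV' = PV \<union> AV"
  define w where "w = pick cfg (min_nonnbr A B)"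
  define left' where "left' = (card (A - N w) \<le> card (B - N w))"
  define LU where "LU = (if left' then A - N w else {})"
  define LV where "LV = (if left' then {} else B - N w)"
  define us where "us = enum cfg LU"
  define vs where "vs = enum cfg LV"
  have A': "A = CU - AU" and B': "B = CV - AV"
    unfolding A B AU_def AV_def core_U_def core_V_def by simp_all
  have time: "time CU CV PU PV HU HV = (card CU * card CV + 1)
      + (card CU * card CV + card AU + card A * card CV + card AV)
      + ((card A + card B)\<^sup>2 + card A + card B)
      + (\<Sum>i<length us. card (A - set (take (Suc i) us)) + card B + 1
          + time (A - set (take (Suc i) us)) (B \<inter> N (us ! i)) PU' PV' (HU \<union> {us ! i}) HV)
      + (\<Sum>i<length vs. card (A - LU) + card (B - set (take (Suc i) vs)) + 1
          + time ((A - LU) \<inter> N (vs ! i)) (B - set (take (Suc i) vs)) PU' PV' HU (HV \<union> {vs ! i}))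
      + 1 + time (A - LU) (B - LV) PU' PV' HU HV"
    unfolding NPC.simps[of CU CV PU PV HU HV] if_not_P[OF nonleaf] Let_def
    unfolding AU_def[symmetric] cfg_def[symmetric]
    unfolding A'[symmetric] PU'_def[symmetric]
    unfolding AV_def[symmetric]
    unfolding B'[symmetric] PV'_def[symmetric]
    unfolding w_def[symmetric]
    unfolding left'_def[symmetric]
    unfolding LU_def[symmetric] LV_def[symmetric]
    unfolding us_def[symmetric] vs_def[symmetric]
    using CU CV by (simp add: snd_sum)
  have sub: "A \<subseteq> CU" "B \<subseteq> CV" "AU \<subseteq> CU" "AV \<subseteq> CV"
    unfolding A' B' AU_def AV_def by auto
  have fin: "finite CU" "finite CV"
    using finite_subset_UV CU CV by auto
  have finAB: "finite A" "finite B"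
    using finite_subset[OF sub(1)] finite_subset[OF sub(2)] fin by auto
  have card_le: "card X \<le> card A" "card Y \<le> card B" "card X \<le> card CU" "card Y \<le> card CV"
    if "X \<subseteq> A" "Y \<subseteq> B" for X Y
    using that sub fin finAB by (auto intro!: card_mono)
  have fin_L: "finite LU" "finite LV"
    using finAB by (auto simp: LU_def LV_def)
  have us: "set us = LU" "distinct us" and vs: "set vs = LV" "distinct vs"
    using enum fin_L unfolding us_def vs_def by auto
  have LU: "LU \<subseteq> A" "LU \<noteq> {} \<Longrightarrow> LU = A - N w \<and> left'" and LV: "LV \<subseteq> B" "LV \<noteq> {} \<Longrightarrow> LV = B - N w \<and> \<not> left'"
    by (auto simp: LU_def LV_def)
  have len: "length us \<le> card CU" "length vs \<le> card CV"
    using card_le(3)[OF LU(1) order_refl] card_le(4)[OF order_refl LV(1)] us vs distinct_card by metis+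
  have drop_less: "card (X - set (take (Suc i) xs)) < card X"
    if "set xs \<subseteq> X" "finite X" "i < length xs" for X :: "'a set" and xs i
    using that nth_mem[of i xs]
    by (intro psubset_card_mono psubsetI) (auto simp: take_Suc_conv_app_nth simp del: nth_mem)
  define SU where "SU = (\<Sum>i<length us. f (A - set (take (Suc i) us)) (B \<inter> N (us ! i)))"
  define SV where "SV = (\<Sum>i<length vs. f ((A - LU) \<inter> N (vs ! i)) (B - set (take (Suc i) vs)))"
  define cu where "cu = (\<lambda>i. card (A - set (take (Suc i) us)) + card B + 1)"
  define cv where "cv = (\<lambda>i. card (A - LU) + card (B - set (take (Suc i) vs)) + 1)"
  \<comment> \<open>The element deleted in the iteration makes up for the \<open>+ 1\<close>, so
    preparing one recursive call costs at most \<open>card CU + card CV\<close>.\<close>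
  have cu: "cu i \<le> card CU + card CV" if "i < length us" for i
    using drop_less[of us A i] that us LU finAB card_le[OF order_refl order_refl] unfolding cu_def by force
  have cv: "cv i \<le> card CU + card CV" if "i < length vs" for i
    using drop_less[of vs B i] that vs LV finAB card_le[OF order_refl order_refl]
      card_le(1)[of "A - LU" "{}"] unfolding cv_def by force
  have "(\<Sum>i<length us. cu i) + (\<Sum>i<length vs. cv i) \<le> (length us + length vs) * (card CU + card CV)"
    using sum_bounded_above[of "{..<length us}" cu "card CU + card CV"] cu
      sum_bounded_above[of "{..<length vs}" cv "card CU + card CV"] cv by (simp add: algebra_simps)
  then have own: "(card CU * card CV + 1)
      + (card CU * card CV + card AU + card A * card CV + card AV)
      + ((card A + card B)\<^sup>2 + card A + card B)
      + ((\<Sum>i<length us. cu i) + (\<Sum>i<length vs. cv i)) + 1 \<le> 6 * (card CU + card CV + 1)\<^sup>2"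
    using len card_le[OF order_refl order_refl] sub fin
    by (intro call_cost_le[where k = "length us + length vs"]) (auto intro: card_mono)
  have tu: "real (time (A - set (take (Suc i) us)) (B \<inter> N (us ! i)) PU' PV' (HU \<union> {us ! i}) HV)
      \<le> f (A - set (take (Suc i) us)) (B \<inter> N (us ! i))" if "i < length us" for i
    using drop_less[of us A i] that us LU finAB sub card_le(3)[OF order_refl order_refl]
      card_le(4)[of A "B \<inter> N (us ! i)"]
    by (intro IH[rule_format]) auto
  have tv: "real (time ((A - LU) \<inter> N (vs ! i)) (B - set (take (Suc i) vs)) PU' PV' HU (HV \<union> {vs ! i}))
      \<le> f ((A - LU) \<inter> N (vs ! i)) (B - set (take (Suc i) vs))" if "i < length vs" for i
    using drop_less[of vs B i] that vs LV finAB sub card_le(4)[OF order_refl order_refl]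
      card_le(3)[of "(A - LU) \<inter> N (vs ! i)" B, OF subset_trans[OF Int_lower1 Diff_subset] order_refl]
    by (intro IH[rule_format]) auto
  have "real (time CU CV PU PV HU HV) = real ((card CU * card CV + 1)
      + (card CU * card CV + card AU + card A * card CV + card AV)
      + ((card A + card B)\<^sup>2 + card A + card B)
      + ((\<Sum>i<length us. cu i) + (\<Sum>i<length vs. cv i)) + 1)
      + (\<Sum>i<length us. real (time (A - set (take (Suc i) us)) (B \<inter> N (us ! i)) PU' PV' (HU \<union> {us ! i}) HV))
      + (\<Sum>i<length vs. real (time ((A - LU) \<inter> N (vs ! i)) (B - set (take (Suc i) vs)) PU' PV' HU (HV \<union> {vs ! i})))
      + real (time (A - LU) (B - LV) PU' PV' HU HV)"
    unfolding time cu_def cv_def sum.distrib[symmetric] by (simp add: sum.distrib)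
  also have "\<dots> \<le> cost + SU + SV + real (time (A - LU) (B - LV) PU' PV' HU HV)"
    unfolding SU_def SV_def using own tu tv
    unfolding of_nat_le_iff[where 'a = real, symmetric] cost
    by (intro add_mono sum_mono) (simp_all add: ac_simps)
  finally have bound: "real (time CU CV PU PV HU HV) \<le> cost + SU + SV + real (time (A - LU) (B - LV) PU' PV' HU HV)" .
  show thesis
  proof (cases "A = {} \<and> B = {}")
    case True
    then have "us = []" "vs = []"
      using us vs LU LV by auto
    \<comment> \<open>Without candidates the call of step (6) ends in its step (1), which tests no
      pair; this unit is the \<open>+ 1\<close> of the case \<open>leaf\<close>.\<close>
    moreover have "time (A - LU) (B - LV) PU' PV' HU HV = 1"
      using True by (subst NPC.simps) simp
    ultimately show thesis
      using leaf bound by (simp add: SU_def SV_def)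
  next
    case False
    have AB: "A \<subseteq> U" "B \<subseteq> V"
      using sub CU CV by auto
    \<comment> \<open>The pivot is a non-neighbour of itself and, having survived step (2), has one
      on the other side too. So the loop is not empty and the call of step (6) is strictly
      smaller.\<close>
    have ne: "A - N w \<noteq> {}" "B - N w \<noteq> {}"
      using nonnbr_nonempty[of A B w cfg] finAB AB False w_def
        core_U_nonnbr[of _ CU CV] core_V_nonnbr[of _ CU CV] unfolding A B by auto
    have "w \<in> min_nonnbr A B"
      unfolding w_def using pick min_nonnbr_nonempty finAB False by auto
    then have w: "w \<in> A \<union> B" and
      w_min: "x \<in> A \<union> B \<Longrightarrow> min (card (A - N w)) (card (B - N w)) \<le> min (card (A - N x)) (card (B - N x))" for x
      unfolding min_nonnbr_def by (force simp: is_arg_min_linorder)+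
    have final: "real (time (A - LU) (B - LV) PU' PV' HU HV) \<le> f (A - LU) (B - LV)"
    proof (rule IH[rule_format])
      have "A - LU \<subset> A \<or> B - LV \<subset> B"
        using ne by (auto simp: LU_def LV_def)
      then have "card (A - LU) < card A \<or> card (B - LV) < card B"
        using finAB psubset_card_mono by metis
      then show "card (A - LU) + card (B - LV) < card CU + card CV"
        using card_le[of "A - LU" "B - LV"] card_le[OF order_refl order_refl] by auto
    qed (use sub in auto)
    show thesis
    proof (cases left')
      case True
      then have L: "LU = A - N w" "LV = {}" "vs = []"
        using vs by (auto simp: LU_def LV_def)
      have k: "length us = card (A - N w)"
        using distinct_card us L by metis
      show thesis
      proof (rule left[of w us])
        show "length us \<le> card (A - N x) \<and> length us \<le> card (B - N x)" if "x \<in> A \<union> B" for x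
          using w_min[OF that] True k by (auto simp: left'_def)
      qed (use w us L ne bound final in \<open>auto simp: SU_def SV_def\<close>)
    next
      case False
      then have L: "LV = B - N w" "LU = {}" "us = []"
        using us by (auto simp: LU_def LV_def)
      have k: "length vs = card (B - N w)"
        using distinct_card vs L by metis
      show thesis
      proof (rule right[of w vs])
        show "length vs \<le> card (A - N x) \<and> length vs \<le> card (B - N x)" if "x \<in> A \<union> B" for x
          using w_min[OF that] False k by (auto simp: left'_def)
      qed (use w vs L ne bound final in \<open>auto simp: SU_def SV_def\<close>)
    qed
  qed
qed

section \<open>The size of the recursion tree\<close>

lemma Int_nbrs_same_side:
  "A \<subseteq> U \<Longrightarrow> w \<in> A \<Longrightarrow> A \<inter> N w = {}" "B \<subseteq> V \<Longrightarrow> w \<in> B \<Longrightarrow> B \<inter> N w = {}"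
  using edges disjoint by (auto simp: nbrs_def)

lemma card_Int_nbrs:
  assumes "finite A"
  shows "card (A \<inter> N w) = card A - card (A - N w)" "card (A - N w) \<le> card A"
  using card_Diff_subset_Int[of A "N w"] card_mono[OF assms, of "A - N w"]
    card_mono[OF assms, of "A \<inter> N w"] assms by auto

lemma card_Diff_take:
  assumes "finite A" "set xs \<subseteq> A" "distinct xs" "i < length xs"
  shows "card (A - set (take (Suc i) xs)) = card A - Suc i"
  using assms distinct_card[OF distinct_take[OF assms(3)], of "Suc i"] set_take_subset[of "Suc i" xs]
  by (subst card_Diff_subset) auto

lemma card_core_le:
  "finite CU \<Longrightarrow> card (core_U CU CV) \<le> card CU" "finite CV \<Longrightarrow> card (core_V CU CV) \<le> card CV"
  using core_subset card_mono by metis+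

text \<open>In the call of step (6) the pivot \<open>w\<close> is adjacent to all candidates left on the other side, so
  step (2) of that call removes it: this gives the additional \<open>1\<close>.\<close>

lemma card_core_removed_U:
  assumes "A \<subseteq> U" "B \<subseteq> V" "w \<in> A \<union> B"
  shows "card (core_U (A \<inter> N w) B) + card (core_V (A \<inter> N w) B)
    \<le> card A + card B - (card (A - N w) + 1)"
proof (cases "w \<in> A")
  case True
  \<comment> \<open>One side is now empty, so every candidate on the other side is vacuously fully
    adjacent and step (2) leaves nothing.\<close>
  then have "A \<inter> N w = {}"
    using Int_nbrs_same_side(1) assms(1) by blast
  then show ?thesis
    by (simp add: core_U_def core_V_def)
next
  case False
  then have w: "w \<in> B"
    using assms by blast
  have fin: "finite A" "finite B"
    using finite_subset_UV assms by auto
  have "core_V (A \<inter> N w) B \<subseteq> B - {w}"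
    by (auto simp: core_V_def core_U_def)
  then have "card (core_V (A \<inter> N w) B) \<le> card B - 1"
    using card_mono[of "B - {w}"] fin w by simp
  moreover have "card (core_U (A \<inter> N w) B) \<le> card A - card (A - N w)"
    using card_core_le(1)[of "A \<inter> N w" B] fin card_Int_nbrs(1) by simp
  moreover have "0 < card B"
    using w fin card_gt_0_iff by blast
  ultimately show ?thesis
    using card_Int_nbrs(2)[OF fin(1), of w] by simp
qed

text \<open>The same argument with the sides exchanged, except that a pivot on the other side is now
  removed in the first half of step (2).\<close>

lemma card_core_removed_V:
  assumes "A \<subseteq> U" "B \<subseteq> V" "w \<in> A \<union> B"
  shows "card (core_U A (B \<inter> N w)) + card (core_V A (B \<inter> N w))
    \<le> card A + card B - (card (B - N w) + 1)"
proof (cases "w \<in> B")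
  case True
  then have "B \<inter> N w = {}"
    using Int_nbrs_same_side(2) assms(2) by blast
  then show ?thesis
    by (simp add: core_U_def core_V_def)
next
  case False
  then have w: "w \<in> A"
    using assms by blast
  have fin: "finite A" "finite B"
    using finite_subset_UV assms by auto
  have "core_U A (B \<inter> N w) \<subseteq> A - {w}"
    by (auto simp: core_U_def)
  then have "card (core_U A (B \<inter> N w)) \<le> card A - 1"
    using card_mono[of "A - {w}"] fin w by simp
  moreover have "card (core_V A (B \<inter> N w)) \<le> card B - card (B - N w)"
    using card_core_le(2)[of "B \<inter> N w" A] fin card_Int_nbrs(1) by simp
  moreover have "0 < card A"
    using w fin card_gt_0_iff by blast
  ultimately show ?thesis
    using card_Int_nbrs(2)[OF fin(2), of w] by simp
qed

text \<open>The exponential part counts only survivors of step (2), so that the pivot removed by the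
  next step (2) is credited. The quadratic term pays for the work on all candidates; in a recursive
  call these are survivors of the caller, whose \<open>call_bound\<close> covers that term through
  \<open>call_bound_step\<close>.\<close>

lemma NPC_time_le_core:
  assumes "CU \<subseteq> U" "CV \<subseteq> V"
  shows "real (time CU CV PU PV HU HV) \<le> 6 * (real (card CU + card CV) + 1)\<^sup>2
    + call_bound (card (core_U CU CV) + card (core_V CU CV))"
  using assms
proof (induction "card CU + card CV" arbitrary: CU CV PU PV HU HV rule: less_induct)
  case less
  define f where "f = (\<lambda>X Y. 6 * (real (card X + card Y) + 1)\<^sup>2
    + call_bound (card (core_U X Y) + card (core_V X Y)))"
  define A where "A = core_U CU CV"
  define B where "B = core_V CU CV"
  define m where "m = card A + card B"
  define cost where "cost = 6 * (real (card CU + card CV) + 1)\<^sup>2"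
  have sub: "A \<subseteq> U" "B \<subseteq> V"
    using core_subset less.prems unfolding A_def B_def by blast+
  then have fin: "finite A" "finite B"
    using finite_subset_UV by auto
  have IH: "real (time X Y PU PV HU HV) \<le> f X Y"
    if "X \<subseteq> CU" "Y \<subseteq> CV" "card X + card Y < card CU + card CV" for X Y PU PV HU HV
    unfolding f_def using that less.prems by (intro less.hyps) auto
  then have IH': "\<forall>X Y PU PV HU HV. X \<subseteq> CU \<longrightarrow> Y \<subseteq> CV \<longrightarrow> card X + card Y < card CU + card CV \<longrightarrow>
      real (time X Y PU PV HU HV) \<le> f X Y"
    by blast
  have f_le: "f X Y \<le> 6 * (real m + 1)\<^sup>2 + call_bound n"
    if "X \<subseteq> A" "Y \<subseteq> B" "card (core_U X Y) + card (core_V X Y) \<le> n" for X Y n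
    unfolding f_def using that fin card_mono[of A X] card_mono[of B Y]
    by (intro add_mono call_bound_mono mult_left_mono power_mono) (auto simp: m_def)
  \<comment> \<open>The form shared by branching on \<open>U\<close> and on \<open>V\<close>:
    \<open>g\<close> stands for the loop calls, \<open>h\<close> for the call of step (6). As
    \<open>k\<close> is at most the size of each side, \<open>2 * k \<le> m\<close>.\<close>
  have goal: ?case
    if "1 \<le> k" "k \<le> card A" "k \<le> card B" "\<And>i. i < k \<Longrightarrow> g i \<le> 6 * (real m + 1)\<^sup>2 + call_bound (m - (k + Suc i))"
      "h \<le> 6 * (real m + 1)\<^sup>2 + call_bound (m - (k + 1))"
      "real (time CU CV PU PV HU HV) \<le> cost + (\<Sum>i<k. g i) + h" for k g h
  proof -
    have "(\<Sum>i<k. g i) \<le> (\<Sum>i<k. 6 * (real m + 1)\<^sup>2 + call_bound (m - (k + Suc i)))"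
      using that by (intro sum_mono) auto
    then show ?thesis
      using call_bound_step[of k m] that unfolding A_def[symmetric] B_def[symmetric]
        cost_def[symmetric] m_def[symmetric] by (simp add: m_def)
  qed
  from less.prems IH' A_def B_def cost_def show ?case
  proof (cases rule: NPC_time_cases[where PU = PU and PV = PV and HU = HU and HV = HV])
    case leaf
    then show ?thesis
      using call_bound_ge[of "card (core_U CU CV) + card (core_V CU CV)"] by (simp add: cost_def)
  next
    case (left w us)
    have us: "length us = card (A - N w)"
      using left distinct_card by metis
    show ?thesis
    proof (rule goal[OF _ _ _ _ _ left(6)])
      show "1 \<le> length us"
        using left(3) by (cases us) auto
      show "length us \<le> card A" "length us \<le> card B"
        using left(5)[OF left(1)] card_Int_nbrs(2) fin order_trans by metis+
      show "f (A - set (take (Suc i) us)) (B \<inter> N (us ! i))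
        \<le> 6 * (real m + 1)\<^sup>2 + call_bound (m - (length us + Suc i))" if i: "i < length us" for i
      proof (rule f_le)
        have "us ! i \<in> A"
          using i left(4) nth_mem by blast
        \<comment> \<open>\<open>us ! i\<close> is itself a candidate, so the minimality of the
          pivot gives it at least \<open>length us\<close> non-neighbours on the other side.\<close>
        then have "length us \<le> card (B - N (us ! i))"
          using left(5) by blast
        then have "card (B \<inter> N (us ! i)) \<le> card B - length us"
          using card_Int_nbrs[OF fin(2)] by simp
        moreover have "card (A - set (take (Suc i) us)) = card A - Suc i"
          using card_Diff_take fin(1) left i by auto
        moreover have "Suc i \<le> card A" "length us \<le> card B"
          using i us card_Int_nbrs(2)[OF fin(1), of w] card_Int_nbrs(2)[OF fin(2), of w] left(1,5)
          by force+
        ultimately show "card (core_U (A - set (take (Suc i) us)) (B \<inter> N (us ! i)))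
          + card (core_V (A - set (take (Suc i) us)) (B \<inter> N (us ! i))) \<le> m - (length us + Suc i)"
          using card_core_le(1)[of "A - set (take (Suc i) us)" "B \<inter> N (us ! i)"]
            card_core_le(2)[of "B \<inter> N (us ! i)" "A - set (take (Suc i) us)"] fin
          by (simp add: m_def)
      qed auto
      have "A - set us = A \<inter> N w"
        using left(4) by blast
      then show "f (A - set us) B \<le> 6 * (real m + 1)\<^sup>2 + call_bound (m - (length us + 1))"
        using f_le card_core_removed_U[OF sub left(1)] us unfolding m_def by simp
    qed
  next
    case (right w vs)
    have vs: "length vs = card (B - N w)"
      using right distinct_card by metis
    show ?thesis
    proof (rule goal[OF _ _ _ _ _ right(6)])
      show "1 \<le> length vs"
        using right(3) by (cases vs) auto
      show "length vs \<le> card A" "length vs \<le> card B"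
        using right(5)[OF right(1)] card_Int_nbrs(2) fin order_trans by metis+
      show "f (A \<inter> N (vs ! i)) (B - set (take (Suc i) vs))
        \<le> 6 * (real m + 1)\<^sup>2 + call_bound (m - (length vs + Suc i))" if i: "i < length vs" for i
      proof (rule f_le)
        have "vs ! i \<in> B"
          using i right(4) nth_mem by blast
        then have "length vs \<le> card (A - N (vs ! i))"
          using right(5) by blast
        then have "card (A \<inter> N (vs ! i)) \<le> card A - length vs"
          using card_Int_nbrs[OF fin(1)] by simp
        moreover have "card (B - set (take (Suc i) vs)) = card B - Suc i"
          using card_Diff_take fin(2) right i by auto
        moreover have "Suc i \<le> card B" "length vs \<le> card A"
          using i vs card_Int_nbrs(2)[OF fin(1), of w] card_Int_nbrs(2)[OF fin(2), of w] right(1,5)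
          by force+
        ultimately show "card (core_U (A \<inter> N (vs ! i)) (B - set (take (Suc i) vs)))
          + card (core_V (A \<inter> N (vs ! i)) (B - set (take (Suc i) vs))) \<le> m - (length vs + Suc i)"
          using card_core_le(1)[of "A \<inter> N (vs ! i)" "B - set (take (Suc i) vs)"]
            card_core_le(2)[of "B - set (take (Suc i) vs)" "A \<inter> N (vs ! i)"] fin
          by (simp add: m_def)
      qed auto
      have "B - set vs = B \<inter> N w"
        using right(4) by blast
      then show "f A (B - set vs) \<le> 6 * (real m + 1)\<^sup>2 + call_bound (m - (length vs + 1))"
        using f_le card_core_removed_V[OF sub right(1)] vs unfolding m_def by simp
    qed
  qed
qed

section \<open>Time bounds in terms of the initial candidates\<close>

lemma NPC_time_le_exp:
  assumes exp: "\<And>m. 6 * (real m + 1)\<^sup>2 + call_bound m \<le> \<beta> * sqrt 2 ^ m"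
    and "CU \<subseteq> U" "CV \<subseteq> V"
  shows "real (time CU CV PU PV HU HV) \<le> \<beta> * sqrt 2 ^ (card CU + card CV)"
proof -
  have "call_bound (card (core_U CU CV) + card (core_V CU CV)) \<le> call_bound (card CU + card CV)"
    using assms finite_subset_UV by (intro call_bound_mono add_mono card_core_le) auto
  then show ?thesis
    using NPC_time_le_core[of CU CV PU PV HU HV] exp[of "card CU + card CV"] assms by simp
qed

text \<open>For node splitting \<open>C_U\<close> can be much larger than \<open>n_max\<close>. But a pivot has at most \<open>d\<close> neighbours
  in \<open>C_U\<close>, so every recursive call, except the one of step (6) after branching on \<open>V\<close>, has only
  \<open>d + card CV\<close> candidates, up to the geometric saving along the loop; and the exceptional
  calls form a chain along which \<open>C_V\<close> shrinks.\<close>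

lemma NPC_time_le_degree:
  assumes exp: "\<And>m. 6 * (real m + 1)\<^sup>2 + call_bound m \<le> \<beta> * sqrt 2 ^ m"
    and "CU \<subseteq> U" "CV \<subseteq> V" "\<And>v. v \<in> CV \<Longrightarrow> card (CU \<inter> N v) \<le> d" "card CU \<le> M"
  shows "real (time CU CV PU PV HU HV) \<le> 12 * \<beta> * sqrt 2 ^ (d + card CV)
    + (real (card CV) + 1) * (6 * (real (M + card CV) + 1)\<^sup>2)"
  using assms(2-)
proof (induction "card CU + card CV" arbitrary: CU CV PU PV HU HV rule: less_induct)
  case less
  define P where "P = (\<lambda>y. 6 * (real (M + y) + 1)\<^sup>2)"
  \<comment> \<open>Recursive calls satisfy two bounds: the exponential one is used where few
    candidates are left, the induction hypothesis only for the call of step (6) after branching on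
    \<open>V\<close>.\<close>
  define f where "f = (\<lambda>(X :: 'a set) (Y :: 'a set). min (\<beta> * sqrt 2 ^ (card X + card Y))
    (12 * \<beta> * sqrt 2 ^ (d + card Y) + (real (card Y) + 1) * P (card Y)))"
  define A where "A = core_U CU CV"
  define B where "B = core_V CU CV"
  define b where "b = card CV"
  define Q where "Q = \<beta> * sqrt 2 ^ (d + b)"
  define cost where "cost = 6 * (real (card CU + card CV) + 1)\<^sup>2"
  have \<beta>: "12 \<le> \<beta>"
    using exp[of 0] by simp
  have P_nonneg: "0 \<le> P y" for y
    by (simp add: P_def)
  have P_mono: "P x \<le> P y" if "x \<le> y" for x y
    unfolding P_def using that by (intro mult_left_mono power_mono) auto
  have cost: "cost \<le> P b"
    unfolding cost_def P_def b_def using less.prems by (intro mult_left_mono power_mono) auto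
  have "12 * 1 \<le> Q"
    unfolding Q_def using \<beta> by (intro mult_mono) auto
  have sub: "A \<subseteq> CU" "B \<subseteq> CV" "A \<subseteq> U" "B \<subseteq> V"
    using core_subset less.prems unfolding A_def B_def by blast+
  have fin: "finite CU" "finite CV" "finite A" "finite B"
    using finite_subset_UV less.prems sub by auto
  have B_le: "card B \<le> b"
    unfolding b_def using sub fin by (intro card_mono)
  have IH: "real (time X Y PU PV HU HV) \<le> f X Y"
    if "X \<subseteq> CU" "Y \<subseteq> CV" "card X + card Y < card CU + card CV" for X Y PU PV HU HV
    unfolding f_def P_def
  proof (rule min.boundedI)
    show "real (time X Y PU PV HU HV) \<le> \<beta> * sqrt 2 ^ (card X + card Y)"
      using that less.prems by (intro NPC_time_le_exp exp) auto
    have "card (X \<inter> N v) \<le> d" if "v \<in> Y" for v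
    proof -
      have "card (X \<inter> N v) \<le> card (CU \<inter> N v)"
        using \<open>X \<subseteq> CU\<close> fin by (intro card_mono) auto
      then show ?thesis
        using less.prems(3)[of v] that \<open>Y \<subseteq> CV\<close> by force
    qed
    moreover have "card X \<le> M"
      using card_mono[OF fin(1) that(1)] less.prems(4) by simp
    ultimately show "real (time X Y PU PV HU HV) \<le> 12 * \<beta> * sqrt 2 ^ (d + card Y)
        + (real (card Y) + 1) * (6 * (real (M + card Y) + 1)\<^sup>2)"
      using that less.prems by (intro less.hyps) auto
  qed
  then have IH': "\<forall>X Y PU PV HU HV. X \<subseteq> CU \<longrightarrow> Y \<subseteq> CV \<longrightarrow> card X + card Y < card CU + card CV \<longrightarrow>
      real (time X Y PU PV HU HV) \<le> f X Y"
    by blast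
  have deg: "card (A \<inter> N v) \<le> d" if "v \<in> A \<union> B" for v
  proof (cases "v \<in> A")
    case True
    then show ?thesis
      using Int_nbrs_same_side(1)[OF sub(3)] by simp
  next
    case False
    then have "card (CU \<inter> N v) \<le> d"
      using that sub less.prems(3) by blast
    moreover have "card (A \<inter> N v) \<le> card (CU \<inter> N v)"
      using sub fin by (intro card_mono) auto
    ultimately show ?thesis
      by simp
  qed
  have f_exp: "f X Y \<le> \<beta> * sqrt 2 ^ n" if "card X + card Y \<le> n" for X Y n
  proof -
    have "f X Y \<le> \<beta> * sqrt 2 ^ (card X + card Y)"
      by (simp add: f_def)
    also have "\<dots> \<le> \<beta> * sqrt 2 ^ n"
      using that \<beta> by (intro mult_left_mono power_increasing) auto
    finally show ?thesis .
  qed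
  \<comment> \<open>Loop calls that lose one more candidate in each iteration form a geometric
    series below \<open>Q\<close>; iterations count from 0, hence \<open>Suc i\<close>.\<close>
  have loop: "(\<Sum>i<k. f (X i) (Y i)) \<le> 5 / 2 * Q"
    if "\<And>i. i < k \<Longrightarrow> card (X i) + card (Y i) + Suc i \<le> d + b" for k and X Y :: "nat \<Rightarrow> 'a set"
  proof -
    have "(\<Sum>i<k. f (X i) (Y i)) \<le> (\<Sum>i<k. Q * (1 / sqrt 2 ^ Suc i))"
    proof (rule sum_mono)
      fix i assume "i \<in> {..<k}"
      then have i: "card (X i) + card (Y i) + Suc i \<le> d + b"
        using that by simp
      then have "f (X i) (Y i) \<le> \<beta> * sqrt 2 ^ (d + b - Suc i)"
        by (intro f_exp) simp
      also have "\<dots> = Q * (1 / sqrt 2 ^ Suc i)"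
        using i unfolding Q_def by (subst power_diff) auto
      finally show "f (X i) (Y i) \<le> Q * (1 / sqrt 2 ^ Suc i)" .
    qed
    also have "\<dots> = Q * (\<Sum>i<k. 1 / sqrt 2 ^ Suc i)"
      by (simp only: sum_distrib_left)
    also have "\<dots> \<le> Q * (5 / 2)"
      using \<open>12 * 1 \<le> Q\<close> by (intro mult_left_mono geometric_sum_le) auto
    finally show ?thesis
      by simp
  qed
  have goal: ?case if "real (time CU CV PU PV HU HV) \<le> 12 * Q + (real b + 1) * P b"
    using that unfolding Q_def P_def b_def by (simp add: mult.assoc)
  have bP: "0 \<le> real b * P b"
    using P_nonneg by simp
  from less.prems(1,2) IH' A_def B_def cost_def show ?case
  proof (cases rule: NPC_time_cases[where PU = PU and PV = PV and HU = HU and HV = HV])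
    case leaf
    then show ?thesis
      using cost bP \<open>12 * 1 \<le> Q\<close> by (intro goal) (simp add: distrib_right)
  next
    case (left w us)
    have us: "length us = card (A - N w)"
      using left distinct_card by metis
    \<comment> \<open>The pivot has at most \<open>d\<close> neighbours in \<open>A\<close>, so
      \<open>card A\<close> exceeds \<open>d\<close> by at most \<open>length us\<close>. Every loop
      call loses at least \<open>length us\<close> candidates of \<open>B\<close>, which cancels
      this excess.\<close>
    have A_w: "card A \<le> d + length us" "A - set us = A \<inter> N w"
      using deg[OF left(1)] card_Int_nbrs(1)[OF fin(3), of w] us left(4) by auto
    have "(\<Sum>i<length us. f (A - set (take (Suc i) us)) (B \<inter> N (us ! i))) \<le> 5 / 2 * Q"
    proof (rule loop)
      fix i assume i: "i < length us"
      then have "us ! i \<in> A"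
        using left(4) nth_mem by blast
      then have "length us \<le> card (B - N (us ! i))"
        using left(5) by blast
      then have "card (B \<inter> N (us ! i)) \<le> card B - length us" "length us \<le> card B"
        using card_Int_nbrs[OF fin(4), of "us ! i"] by auto
      moreover have "card (A - set (take (Suc i) us)) = card A - Suc i"
        using card_Diff_take fin(3) left i by auto
      ultimately show "card (A - set (take (Suc i) us)) + card (B \<inter> N (us ! i)) + Suc i \<le> d + b"
        using A_w(1) B_le us i card_Int_nbrs(2)[OF fin(3), of w] by simp
    qed
    moreover have "f (A - set us) B \<le> Q"
      unfolding Q_def A_w(2) using deg[OF left(1)] B_le by (intro f_exp) simp
    ultimately show ?thesis
      using left(6) cost bP \<open>12 * 1 \<le> Q\<close> by (intro goal) (simp add: distrib_right)
  next
    case (right w vs)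
    have "(\<Sum>i<length vs. f (A \<inter> N (vs ! i)) (B - set (take (Suc i) vs))) \<le> 5 / 2 * Q"
    proof (rule loop)
      fix i assume i: "i < length vs"
      then have "vs ! i \<in> B"
        using right(4) nth_mem by blast
      moreover have "card (B - set (take (Suc i) vs)) = card B - Suc i"
        using card_Diff_take fin(4) right i by auto
      moreover have "length vs \<le> card B"
        using right(5)[OF right(1)] card_Int_nbrs(2)[OF fin(4), of w] by simp
      ultimately show "card (A \<inter> N (vs ! i)) + card (B - set (take (Suc i) vs)) + Suc i \<le> d + b"
        using deg[of "vs ! i"] B_le i by simp
    qed
    \<comment> \<open>\<open>B\<close> shrinks, so the exponential part gains a factor
      \<open>1 / sqrt 2\<close>, and \<open>12 / sqrt 2 \<le> 9\<close>. The constant 12 leaves room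
      for the loop, as \<open>5 / 2 + 9 \<le> 12\<close>; the own cost, at most \<open>P b\<close>,
      completes \<open>(b + 1) * P b\<close>.\<close>
    moreover have "f A (B - set vs) \<le> 9 * Q + real b * P b"
    proof -
      have "B - set vs \<subset> B"
        using right(3,4) by (cases vs) auto
      then have less: "Suc (card (B - set vs)) \<le> b"
        using psubset_card_mono[OF fin(4)] B_le by (meson Suc_leI less_le_trans)
      have "f A (B - set vs) \<le> 12 * \<beta> * sqrt 2 ^ (d + card (B - set vs))
          + (real (card (B - set vs)) + 1) * P (card (B - set vs))"
        by (simp add: f_def)
      also have "\<dots> \<le> 12 * \<beta> * sqrt 2 ^ (d + (b - 1)) + real b * P b"
        using less \<beta> P_nonneg
        by (intro add_mono mult_mono power_increasing P_mono mult_left_mono) auto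
      also have "12 * \<beta> * sqrt 2 ^ (d + (b - 1)) = 12 / sqrt 2 * Q"
        using less unfolding Q_def by (cases b) auto
      also have "12 / sqrt 2 * Q \<le> 9 * Q"
      proof (rule mult_right_mono)
        have "4 / 3 \<le> sqrt (2::real)"
          by (rule real_le_rsqrt) (simp add: power2_eq_square)
        then show "12 / sqrt 2 \<le> (9::real)"
          by (simp add: divide_le_eq)
      qed (use \<open>12 * 1 \<le> Q\<close> in simp)
      finally show ?thesis
        by simp
    qed
    ultimately show ?thesis
      using right(6) cost \<open>12 * 1 \<le> Q\<close> by (intro goal) (simp add: distrib_right)
  qed
qed

section \<open>The total running time\<close>

lemma nbrs_U: "u \<in> U \<Longrightarrow> N u \<subseteq> V" and nbrs_V: "v \<in> V \<Longrightarrow> N v \<subseteq> U"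
  using edges disjoint by (auto simp: nbrs_def)

lemma sum_degree_U: "(\<Sum>u\<in>U. card (N u)) = card E"
proof -
  have "finite (N u)" if "u \<in> U" for u
    using nbrs_U[OF that] finite_V finite_subset by blast
  then have "(\<Sum>u\<in>U. card (N u)) = card (Sigma U N)"
    using finite_U by simp
  also have "Sigma U N = E"
    using edges disjoint by (auto simp: nbrs_def)
  finally show ?thesis .
qed

text \<open>Every edge gives at most one edge-split root, and every node of \<open>U\<close> at most
  one node-split root. Each root costs a constant multiple of \<open>r\<close>, and \<open>K\<close>
  converts the number of nodes into a number of edges.\<close>

lemma running_time_le:
  assumes exp: "\<And>m. 6 * (real m + 1)\<^sup>2 + call_bound m \<le> \<beta> * sqrt 2 ^ m"
    and poly: "\<And>n. (real n + 1) ^ 5 \<le> \<gamma> * sqrt 2 ^ n"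
    and "E \<noteq> {}" and K: "card U \<le> K * card E"
  shows "real running_time \<le> (1 + \<beta> + \<gamma> + real K * (1 + 12 * \<beta> + 7 * \<gamma>))
    * (real (card E) * sqrt 2 ^ n_max U V E)"
proof -
  define d where "d = Max ((\<lambda>u. card (N u)) ` U)"
  define D where "D = Max ((\<lambda>v. card (N v)) ` V)"
  define n where "n = n_max U V E"
  define r :: real where "r = sqrt 2 ^ n"
  have n: "n = d + D"
    by (simp add: n_def n_max_def d_def D_def)
  have d: "card (N u) \<le> d" if "u \<in> U" for u
    unfolding d_def using that finite_U by (intro Max_ge) auto
  have D: "card (N v) \<le> D" if "v \<in> V" for v
    unfolding D_def using that finite_V by (intro Max_ge) auto
  have fin: "finite (N u)" if "u \<in> U \<or> u \<in> V" for u
    using that finite_subset[OF nbrs_U finite_V] finite_subset[OF nbrs_V finite_U] by auto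
  have \<beta>: "12 \<le> \<beta>" and \<gamma>: "1 \<le> \<gamma>"
    using exp[of 0] poly[of 0] by simp_all
  have r: "1 \<le> r"
    by (simp add: r_def)
  have poly': "x \<le> \<gamma> * r" if "x \<le> (real n + 1) ^ 5" for x
    using that poly[of n] by (simp add: r_def)
  have edge_bound: "real (card (N v) + card (N u) + 1
      + time {u' \<in> N v. R u < R u'} {v' \<in> N u. R v < R v'} {} {} {u} {v}) \<le> (\<beta> + \<gamma>) * r"
    if "u \<in> U" "v \<in> N u" for u v
  proof -
    have v: "v \<in> V"
      using that nbrs_U by blast
    have "card {u' \<in> N v. R u < R u'} \<le> card (N v)" "card {v' \<in> N u. R v < R v'} \<le> card (N u)"
      using fin that(1) v by (auto intro!: card_mono)
    then have le: "card {u' \<in> N v. R u < R u'} + card {v' \<in> N u. R v < R v'} \<le> n"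
      using d[OF that(1)] D[OF v] by (simp add: n)
    have "real (time {u' \<in> N v. R u < R u'} {v' \<in> N u. R v < R v'} {} {} {u} {v})
        \<le> \<beta> * sqrt 2 ^ (card {u' \<in> N v. R u < R u'} + card {v' \<in> N u. R v < R v'})"
      using nbrs_U[OF that(1)] nbrs_V[OF v] by (intro NPC_time_le_exp exp) auto
    also have "\<dots> \<le> \<beta> * r"
      unfolding r_def using le \<beta> by (intro mult_left_mono power_increasing) auto
    finally have "real (time {u' \<in> N v. R u < R u'} {v' \<in> N u. R v < R v'} {} {} {u} {v}) \<le> \<beta> * r" .
    moreover have "real (card (N v) + card (N u) + 1) \<le> real n + 1"
      using d[OF that(1)] D[OF v] by (simp add: n)
    moreover have "real n + 1 \<le> \<gamma> * r"
      using power_increasing[of 1 5 "real n + 1"] by (intro poly') simp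
    ultimately show ?thesis
      by (simp add: distrib_right)
  qed
  have node_bound: "real ((\<Sum>v\<in>N u. card (N v)) + card (N u) + 1
      + time {u' \<in> U. R u < R u' \<and> N u' \<inter> N u \<noteq> {}} (N u) {} {} {u} {}) \<le> (12 * \<beta> + 7 * \<gamma>) * r"
    if u: "u \<in> U" for u
  proof -
    let ?CU = "{u' \<in> U. R u < R u' \<and> N u' \<inter> N u \<noteq> {}}"
    define M where "M = (\<Sum>v\<in>N u. card (N v))"
    define b where "b = card (N u)"
    have b: "b \<le> d"
      using d u by (simp add: b_def)
    have "M \<le> b * D"
      unfolding M_def b_def using D nbrs_U[OF u] sum_bounded_above[of "N u" "\<lambda>v. card (N v)" D] by auto
    also have "\<dots> \<le> n * n"
      using b by (intro mult_le_mono) (auto simp: n)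
    \<comment> \<open>\<open>M\<close> will bound the size of \<open>C_U\<close>. As it is quadratic
      in \<open>n\<close>, the term \<open>(b + 1) * (M + b + 1) ^ 2\<close> is at most
      \<open>(n + 1) ^ 5\<close>, hence the exponent in \<open>poly\<close>.\<close>
    finally have M: "M + b + 1 \<le> (n + 1)\<^sup>2"
      using b by (simp add: n power2_eq_square)
    have "?CU \<subseteq> (\<Union>v\<in>N u. N v)"
      using nbrs_sym by blast
    then have "card ?CU \<le> card (\<Union>v\<in>N u. N v)"
      using fin u nbrs_U[OF u] by (intro card_mono) auto
    also have "\<dots> \<le> M"
      unfolding M_def using fin u by (intro card_UN_le) auto
    finally have CU: "card ?CU \<le> M" .
    \<comment> \<open>\<open>D\<close> serves as the degree bound:
      \<open>D + card (N u) \<le> n\<close>, however large \<open>C_U\<close> is.\<close>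
    have deg: "card (?CU \<inter> N v) \<le> D" if "v \<in> N u" for v
    proof -
      have v: "v \<in> V"
        using that nbrs_U[OF u] by blast
      then have "card (?CU \<inter> N v) \<le> card (N v)"
        using fin by (intro card_mono) auto
      then show ?thesis
        using D[OF v] by simp
    qed
    have "real (time ?CU (N u) {} {} {u} {}) \<le> 12 * \<beta> * sqrt 2 ^ (D + card (N u))
        + (real (card (N u)) + 1) * (6 * (real (M + card (N u)) + 1)\<^sup>2)"
      using nbrs_U[OF u] deg CU by (intro NPC_time_le_degree exp) auto
    also have "\<dots> \<le> 12 * \<beta> * r + 6 * (\<gamma> * r)"
    proof (rule add_mono)
      show "12 * \<beta> * sqrt 2 ^ (D + card (N u)) \<le> 12 * \<beta> * r"
        unfolding r_def using b \<beta> by (intro mult_left_mono power_increasing) (auto simp: n b_def)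
      have "real (M + b + 1) \<le> (real n + 1)\<^sup>2"
        using M unfolding of_nat_le_iff[where 'a = real, symmetric] by (simp add: add.commute)
      then have "(real b + 1) * (real (M + b) + 1)\<^sup>2 \<le> (real n + 1) * ((real n + 1)\<^sup>2)\<^sup>2"
        using b by (intro mult_mono power_mono) (auto simp: n)
      also have "\<dots> = (real n + 1) ^ 5"
        by (simp add: power_mult[symmetric] power_Suc[symmetric] del: power_Suc)
      finally have "(real b + 1) * (real (M + b) + 1)\<^sup>2 \<le> \<gamma> * r"
        by (rule poly')
      then show "(real (card (N u)) + 1) * (6 * (real (M + card (N u)) + 1)\<^sup>2) \<le> 6 * (\<gamma> * r)"
        by (simp add: b_def)
    qed
    finally have "real (time ?CU (N u) {} {} {u} {}) \<le> 12 * \<beta> * r + 6 * (\<gamma> * r)" .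
    moreover have "real (M + b + 1) \<le> (real n + 1)\<^sup>2"
      using M unfolding of_nat_le_iff[where 'a = real, symmetric] by (simp add: add.commute)
    moreover have "(real n + 1)\<^sup>2 \<le> \<gamma> * r"
      by (intro poly' power_increasing) auto
    ultimately show ?thesis
      unfolding M_def b_def by (simp add: distrib_right)
  qed
  define root_cost where "root_cost = (\<lambda>u. case s u of
      Edge \<Rightarrow> (\<Sum>v\<in>N u. card (N v) + card (N u) + 1
        + time {u' \<in> N v. R u < R u'} {v' \<in> N u. R v < R v'} {} {} {u} {v})
    | Node \<Rightarrow> (\<Sum>v\<in>N u. card (N v)) + card (N u) + 1
        + time {u' \<in> U. R u < R u' \<and> N u' \<inter> N u \<noteq> {}} (N u) {} {} {u} {})"
  have "running_time = 1 + (\<Sum>u\<in>U. 1 + root_cost u)"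
    unfolding running_time_def NPivoter_def snd_add snd_sum snd_conv
  proof (intro arg_cong2[where f = "(+)"] refl sum.cong)
    fix u
    show "snd (case s u of
        Edge \<Rightarrow> (\<Sum>v\<in>N u. (0, card (N v) + card (N u) + 1)
          + NPC {u' \<in> N v. R u < R u'} {v' \<in> N u. R v < R v'} {} {} {u} {v})
      | Node \<Rightarrow> (0, (\<Sum>v\<in>N u. card (N v)) + card (N u) + 1)
          + NPC {u' \<in> U. R u < R u' \<and> N u' \<inter> N u \<noteq> {}} (N u) {} {} {u} {}) = root_cost u"
      unfolding root_cost_def by (cases "s u") (simp_all add: snd_sum)
  qed
  then have "real running_time = 1 + real (card U) + (\<Sum>u\<in>U. real (root_cost u))"
    by (simp add: sum.distrib)
  \<comment> \<open>Each \<open>u\<close> is charged for both kinds of root, so the bound no longer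
    depends on \<open>s u\<close>.\<close>
  also have "\<dots> \<le> 1 + real (card U) + (\<Sum>u\<in>U. real (card (N u)) * ((\<beta> + \<gamma>) * r) + (12 * \<beta> + 7 * \<gamma>) * r)"
  proof (intro add_mono sum_mono order_refl)
    fix u assume u: "u \<in> U"
    have nonneg: "0 \<le> real (card (N u)) * ((\<beta> + \<gamma>) * r)" "0 \<le> (12 * \<beta> + 7 * \<gamma>) * r"
      using \<beta> \<gamma> r by auto
    show "real (root_cost u) \<le> real (card (N u)) * ((\<beta> + \<gamma>) * r) + (12 * \<beta> + 7 * \<gamma>) * r"
    proof (cases "s u")
      case Node
      then have "real (root_cost u) \<le> (12 * \<beta> + 7 * \<gamma>) * r"
        using node_bound[OF u] by (simp add: root_cost_def)
      then show ?thesis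
        using nonneg by simp
    next
      case Edge
      then have "real (root_cost u) = (\<Sum>v\<in>N u. real (card (N v) + card (N u) + 1
        + time {u' \<in> N v. R u < R u'} {v' \<in> N u. R v < R v'} {} {} {u} {v}))"
        by (simp add: root_cost_def)
      also have "\<dots> \<le> (\<Sum>v\<in>N u. (\<beta> + \<gamma>) * r)"
        using u by (intro sum_mono edge_bound)
      finally show ?thesis
        using nonneg by simp
    qed
  qed
  also have "\<dots> = 1 + real (card U) + real (card E) * ((\<beta> + \<gamma>) * r) + real (card U) * ((12 * \<beta> + 7 * \<gamma>) * r)"
    unfolding sum_degree_U[symmetric] by (simp add: sum.distrib sum_distrib_right)
  also have "\<dots> \<le> real (card E) * r + real (K * card E) * r + real (card E) * ((\<beta> + \<gamma>) * r)
      + real (K * card E) * ((12 * \<beta> + 7 * \<gamma>) * r)"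
  proof (intro add_mono mult_right_mono order_refl)
    have "finite E"
      using edges finite_U finite_V finite_subset by blast
    then have "1 \<le> real (card E)"
      using \<open>E \<noteq> {}\<close> by (simp add: Suc_le_eq card_gt_0_iff)
    then have "1 * 1 \<le> real (card E) * r"
      using r by (intro mult_mono) auto
    then show "1 \<le> real (card E) * r"
      by simp
    have "real (card U) * 1 \<le> real (K * card E) * r"
      using K r unfolding of_nat_le_iff[where 'a = real, symmetric] by (intro mult_mono) auto
    then show "real (card U) \<le> real (K * card E) * r"
      by simp
    show "real (card U) \<le> real (K * card E)"
      using K by (simp only: of_nat_le_iff)
  qed (use \<beta> \<gamma> r in auto)
  also have "\<dots> = (1 + \<beta> + \<gamma> + real K * (1 + 12 * \<beta> + 7 * \<gamma>)) * (real (card E) * sqrt 2 ^ n_max U V E)"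
    unfolding r_def n_def by (simp add: algebra_simps)
  finally show ?thesis .
qed

end

text \<open>The outer loop spends time on every node of \<open>U\<close>, isolated ones included, so
  a bound in \<open>card E\<close> presupposes \<open>card U = O(card E)\<close>; \<open>K\<close>
  is the constant of this relation. An edge pays for the initial unit and makes \<open>U\<close> and
  \<open>V\<close> nonempty, so that the maxima in \<open>n_max\<close> exist. \<open>C\<close> is
  fixed before the graph, the splits and the choices \<open>pick\<close> and
  \<open>enum\<close>.\<close>

theorem theorem4p7:
  fixes K :: nat
  shows "\<exists>C::real. \<forall>(U::'a set) V E p q R s pick enum.
    npivoter U V E p q R pick enum \<longrightarrow> E \<noteq> {} \<longrightarrow> card U \<le> K * card E \<longrightarrow>
    real (npivoter.running_time U V E p q R s pick enum)
      \<le> C * (real (card E) * 2 powr (real (n_max U V E) / 2))"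
proof -
  obtain \<beta> where \<beta>: "\<And>m. 6 * (real m + 1)\<^sup>2 + call_bound m \<le> \<beta> * sqrt 2 ^ m"
    using call_bound_exp by blast
  obtain \<gamma> where \<gamma>: "\<And>n. (real n + 1) ^ 5 \<le> \<gamma> * sqrt 2 ^ n"
    using poly_le_sqrt2_power by blast
  have "2 powr (real n / 2) = sqrt 2 ^ n" for n
    by (simp add: powr_half_sqrt[symmetric] powr_realpow[symmetric] powr_powr)
  then show ?thesis
    using npivoter.running_time_le[OF _ \<beta> \<gamma>] by (intro exI allI impI) (simp, blast)
qed

end
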